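(* Let $q:=\min\{k\in[0,T-1]:\delta_k=0\}$. Then $\ell_{\min}=q$ and $n_{\min}=\sum_{i=0}^{\ell_{\min}}\delta_i$. Moreover, $\mathcal E(n_{\min})=\mathcal E(\ell_{\min},n_{\min})\subset\mathcal O$.
   Context: Fix integers $m,p\ge 1$ and $T\ge 1$; $[i,j]$ denotes the integers from $i$ to $j$. Matrices with zero rows or columns are allowed (the product of an $a\times 0$ and a $0\times b$ matrix is the zero $a\times b$ matrix; void matrices have rank $0$). Systems. For $n\ge 0$, a system with $n$ states is a matrix $\begin{bmatrix}A&B\\C&D\end{bmatrix}\in\mathbb R^{(n+p)\times(n+m)}$ with $A\in\mathbb R^{n\times n}$, $B\in\mathbb R^{n\times m}$, $C\in\mathbb R^{p\times n}$, $D\in\mathbb R^{p\times m}$, representing $x(t+1)=Ax(t)+Bu(t)$, $y(t)=Cx(t)+Du(t)$. Let $\Omega_{-1}$ be the $0\times n$ matrix and, for $k\ge 0$, let $\Omega_k$ be the matrix obtained by stacking $C,CA,\dots,CA^k$. The lag $\ell(C,A)$ is the smallest integer $k\ge 0$ with $\operatorname{rank}\Omega_k=\operatorname{rank}\Omega_{k-1}$. $\mathcal S(\ell,n)$ is the set of systems with $n$ states and lag $\ell$; $\mathcal S(n)=\bigcup_{\ell\in[0,n]}\mathcal S(\ell,n)$; $\mathcal S=\bigcup_{n\ge 0}\mathcal S(n)$; $\mathcal O\subseteq\mathcal S$ is the set of systems with $(C,A)$ observable. A system is minimal if $(C,A)$ is observable and $(A,B)$ is controllable (for $n=0$ both hold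 by convention). Data. $u_{[0,T-1]}=[u_0\ \cdots\ u_{T-1}]\in\mathbb R^{m\times T}$ and $y_{[0,T-1]}=[y_0\ \cdots\ y_{T-1}]\in\mathbb R^{p\times T}$, with $u_{[0,T-1]}\ne 0$. A system in $\mathcal S(n)$ explains the data if there is $x_{[0,T]}=[x_0\ \cdots\ x_T]\in\mathbb R^{n\times(T+1)}$ with $x_{t+1}=Ax_t+Bu_t$ and $y_t=Cx_t+Du_t$ for all $t\in[0,T-1]$. $\mathcal E$ is the set of all systems explaining the data; $\mathcal E(\ell,n):=\mathcal E\cap\mathcal S(\ell,n)$, $\mathcal E(n):=\mathcal E\cap\mathcal S(n)$. The data are generated by (i.e. explained by) some minimal "true" system. Minimal invariants. $\ell_{\min}:=\min\{\ell\ge 0:\mathcal E(\ell,n)\ne\emptyset\text{ for some }n\ge 0\}$ and $n_{\min}:=\min\{n\ge 0:\mathcal E(n)\ne\emptyset\}$. Hankel matrices and $\delta_k$. For $k\in[0,T-1]$, $H_k=\begin{bmatrix}H_k(u_{[0,T-1]})\\H_k(y_{[0,T-1]})\end{bmatrix}\in\mathbb R^{(k+1)(m+p)\times(T-k)}$, where $H_k(f_{[0,T-1]})$ is the block Hankel matrix whose $(i,j)$ block, $i\in[0,k]$, $j\in[0,T-k-1]$, is $f_{i+j}$; $G_k$ is $H_k$ with its last $p$ rows deleted. $\delta_{-1}:=p$ and $\delta_k:=\operatorname{rank}H_k-\operatorname{rank}G_k$ for $k\in[0,T-1]$. Since $u_{[0,T-1]}\neq0$, $\delta_{T-1}=0$,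 so $q$ is well defined. *)

theory Defs
  imports "Jordan_Normal_Form.DL_Rank"
begin

text \<open>
  Dimensions vary inside the statement (the number of states is minimised over), so matrices are
  those of \<^theory>\<open>Jordan_Normal_Form.Matrix\<close>, where zero rows or columns are allowed.
\<close>

abbreviation mrank :: "real mat \<Rightarrow> nat" where
  "mrank M \<equiv> vec_space.rank (dim_row M) M"

text \<open>
  A system is the tuple of the four blocks of the matrix with block rows \<open>A B\<close> and \<open>C D\<close>;
  its number of states is the dimension of \<open>A\<close>.
\<close>

type_synonym lin_sys = "real mat \<times> real mat \<times> real mat \<times> real mat"

text \<open>
  \<open>obs_mat k C A\<close> stacks the \<open>k\<close> blocks \<open>C, CA, \<dots>, CA\<^sup>k\<^sup>-\<^sup>1\<close>, so the usual \<open>\<Omega>\<^sub>k\<close> is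
  \<open>obs_mat (k + 1) C A\<close>, and \<open>obs_mat 0 C A\<close> is the void matrix \<open>\<Omega>\<^sub>-\<^sub>1\<close>.
\<close>

definition obs_mat :: "nat \<Rightarrow> real mat \<Rightarrow> real mat \<Rightarrow> real mat" where
  "obs_mat k C A = mat (k * dim_row C) (dim_col C)
     (\<lambda>(i, j). (C * A ^\<^sub>m (i div dim_row C)) $$ (i mod dim_row C, j))"

text \<open>\<open>ctrb_mat k A B\<close> is the row of \<open>k\<close> blocks \<open>B, AB, \<dots>, A\<^sup>k\<^sup>-\<^sup>1B\<close>.\<close>

definition ctrb_mat :: "nat \<Rightarrow> real mat \<Rightarrow> real mat \<Rightarrow> real mat" where
  "ctrb_mat k A B = mat (dim_row B) (k * dim_col B)
     (\<lambda>(i, j). (A ^\<^sub>m (j div dim_col B) * B) $$ (i, j mod dim_col B))"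

definition lag :: "real mat \<Rightarrow> real mat \<Rightarrow> nat" where
  "lag C A = (LEAST k. mrank (obs_mat (k + 1) C A) = mrank (obs_mat k C A))"

definition observable :: "real mat \<Rightarrow> real mat \<Rightarrow> bool" where
  "observable C A \<longleftrightarrow> mrank (obs_mat (dim_row A) C A) = dim_row A"

definition controllable :: "real mat \<Rightarrow> real mat \<Rightarrow> bool" where
  "controllable A B \<longleftrightarrow> mrank (ctrb_mat (dim_row A) A B) = dim_row A"

fun minimal_sys :: "lin_sys \<Rightarrow> bool" where
  "minimal_sys (A, B, C, D) \<longleftrightarrow> observable C A \<and> controllable A B"

definition sys_lag :: "nat \<Rightarrow> nat \<Rightarrow> nat \<Rightarrow> nat \<Rightarrow> lin_sys set" where
  "sys_lag m p l n = {(A, B, C, D).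
     A \<in> carrier_mat n n \<and> B \<in> carrier_mat n m \<and> C \<in> carrier_mat p n \<and> D \<in> carrier_mat p m \<and>
     lag C A = l}"

definition sys_states :: "nat \<Rightarrow> nat \<Rightarrow> nat \<Rightarrow> lin_sys set" where
  "sys_states m p n = (\<Union>l\<in>{0..n}. sys_lag m p l n)"

definition systems :: "nat \<Rightarrow> nat \<Rightarrow> lin_sys set" where
  "systems m p = (\<Union>n. sys_states m p n)"

definition obs_systems :: "nat \<Rightarrow> nat \<Rightarrow> lin_sys set" where
  "obs_systems m p = {(A, B, C, D). (A, B, C, D) \<in> systems m p \<and> observable C A}"

text \<open>
  Data are an \<open>m \<times> T\<close> matrix \<open>u\<close> and a \<open>p \<times> T\<close> matrix \<open>y\<close> whose columns are the samples;
  below, \<open>m\<close>, \<open>p\<close> and \<open>T\<close> are read off as \<open>dim_row u\<close>, \<open>dim_row y\<close> and \<open>dim_col u\<close>.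
\<close>

fun explains :: "real mat \<Rightarrow> real mat \<Rightarrow> lin_sys \<Rightarrow> bool" where
  "explains u y (A, B, C, D) \<longleftrightarrow>
     (\<exists>x \<in> carrier_mat (dim_row A) (dim_col u + 1). \<forall>t < dim_col u.
        col x (t + 1) = A *\<^sub>v col x t + B *\<^sub>v col u t \<and>
        col y t = C *\<^sub>v col x t + D *\<^sub>v col u t)"

definition expl :: "real mat \<Rightarrow> real mat \<Rightarrow> lin_sys set" where
  "expl u y = {\<Sigma> \<in> systems (dim_row u) (dim_row y). explains u y \<Sigma>}"

definition expl_lag :: "real mat \<Rightarrow> real mat \<Rightarrow> nat \<Rightarrow> nat \<Rightarrow> lin_sys set" where
  "expl_lag u y l n = expl u y \<inter> sys_lag (dim_row u) (dim_row y) l n"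

definition expl_states :: "real mat \<Rightarrow> real mat \<Rightarrow> nat \<Rightarrow> lin_sys set" where
  "expl_states u y n = expl u y \<inter> sys_states (dim_row u) (dim_row y) n"

definition l_min :: "real mat \<Rightarrow> real mat \<Rightarrow> nat" where
  "l_min u y = (LEAST l. \<exists>n. expl_lag u y l n \<noteq> {})"

definition n_min :: "real mat \<Rightarrow> real mat \<Rightarrow> nat" where
  "n_min u y = (LEAST n. expl_states u y n \<noteq> {})"

text \<open>
  Block Hankel matrix: the block in position \<open>(i, j)\<close>, for \<open>i \<le> k\<close> and \<open>j < T - k\<close>, is the
  column \<open>i + j\<close> of \<open>f\<close>. It is meant for \<open>k < T\<close>.
\<close>

definition hankel :: "nat \<Rightarrow> real mat \<Rightarrow> real mat" where
  "hankel k f = mat ((k + 1) * dim_row f) (dim_col f - k)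
     (\<lambda>(r, j). f $$ (r mod dim_row f, r div dim_row f + j))"

definition H_mat :: "real mat \<Rightarrow> real mat \<Rightarrow> nat \<Rightarrow> real mat" where
  "H_mat u y k = hankel k u @\<^sub>r hankel k y"

definition G_mat :: "real mat \<Rightarrow> real mat \<Rightarrow> nat \<Rightarrow> real mat" where
  "G_mat u y k = mat (dim_row (H_mat u y k) - dim_row y) (dim_col (H_mat u y k))
     (\<lambda>(i, j). H_mat u y k $$ (i, j))"

definition delta :: "real mat \<Rightarrow> real mat \<Rightarrow> nat \<Rightarrow> int" where
  "delta u y k = int (mrank (H_mat u y k)) - int (mrank (G_mat u y k))"

end

theory Submission
  imports Defs
begin

text \<open>
  Order the rows of the data Hankel matrices so that the row of output component \<open>j\<close> at delay \<open>k\<close>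
  comes after all input rows up to delay \<open>k\<close> and all output rows before \<open>(k, j)\<close>. The rank of a
  matrix is the number of rows not spanned by earlier rows, so \<open>\<delta>\<^sub>k\<close> counts the components \<open>j\<close> whose
  row \<open>(k, j)\<close> is new. Once row \<open>(k, j)\<close> is dependent, so is row \<open>(k + 1, j)\<close>, by shifting in time.
  Hence \<open>\<Sum>\<delta>\<^sub>k = \<Sum>d\<^sub>j\<close>, where \<open>d\<^sub>j\<close> is the first delay at which component \<open>j\<close> becomes dependent.

  Lower bounds: if a system explains the data, each dependence between rows of \<open>\<Omega>\<^sub>k\<close> is a dependence
  between data rows, so \<open>\<delta>\<^sub>k \<le> rank \<Omega>\<^sub>k - rank \<Omega>\<^sub>k\<^sub>-\<^sub>1\<close>. This gives \<open>q \<le> \<ell>\<close> and \<open>\<Sum>\<delta>\<^sub>k \<le> n\<close>, and equality in the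
  latter forces observability and \<open>\<ell> = q\<close>.

  Attainment: the dependences at the delays \<open>d\<^sub>j\<close> form difference equations
  with unit lower triangular leading coefficient, which have an observer-form realization with
  \<open>\<Sum>d\<^sub>j\<close> states.
\<close>

section \<open>Row rank and the greedy selection of rows\<close>

lemma (in vec_space) in_span_image_iff:
  fixes k :: nat
  assumes f: "\<And>l. l < k \<Longrightarrow> f l \<in> carrier_vec n" and v: "v \<in> carrier_vec n"
  shows "v \<in> span (f ` {..<k}) \<longleftrightarrow> (\<exists>c. \<forall>j<n. v $ j = (\<Sum>l<k. c l * f l $ j))"
proof -
  \<comment> \<open>The combination is taken over a list, not a set: \<open>f\<close> need not be
    injective, and repeated vectors keep separate coefficients.\<close>
  let ?us = "map f [0..<k]"
  have us: "set ?us \<subseteq> carrier_vec n" using f by auto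
  have index: "lincomb_list c ?us $ j = (\<Sum>l<k. c l * f l $ j)" if "j < n" for c j
    using that us by (subst lincomb_list_as_mat_mult)
      (auto simp: scalar_prod_def atLeast0LessThan mat_of_cols_def mult.commute intro!: sum.cong)
  have dim: "dim_vec (lincomb_list c ?us) = n" for c
    using us by (subst lincomb_list_as_mat_mult) auto
  have "f ` {..<k} = set ?us" by (auto simp: atLeast0LessThan)
  then have "v \<in> span (f ` {..<k}) \<longleftrightarrow> (\<exists>c. v = lincomb_list c ?us)"
    using span_list_as_span[OF us] by (auto simp: span_list_def)
  also have "\<dots> \<longleftrightarrow> (\<exists>c. \<forall>j<n. v $ j = (\<Sum>l<k. c l * f l $ j))"
  proof -
    have "v = lincomb_list c ?us \<longleftrightarrow> (\<forall>j<n. v $ j = (\<Sum>l<k. c l * f l $ j))" for c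
      using v dim[of c] index[of _ c] by (auto simp: vec_eq_iff)
    then show ?thesis by simp
  qed
  finally show ?thesis .
qed

text \<open>Steinitz exchange: a maximal independent set of columns of \<open>A\<close> is an
  independent subset of \<open>span W\<close>, hence no larger than \<open>W\<close>.\<close>

lemma (in vec_space) rank_le_card_span:
  assumes A: "A \<in> carrier_mat n nc" and W: "finite W" "W \<subseteq> carrier_vec n"
    and sub: "set (cols A) \<subseteq> span W"
  shows "rank A \<le> card W"
proof -
  obtain U where U: "maximal U (\<lambda>T. T \<subseteq> set (cols A) \<and> lin_indpt T)"
    using maximal_exists_superset[of "set (cols A)" "\<lambda>T. T \<subseteq> set (cols A) \<and> lin_indpt T" "{}"]
    using lindep_span[of "{}"] by auto
  then have "U \<subseteq> set (cols A)" "lin_indpt U" by (auto simp: maximal_def)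
  moreover from this have "finite U" "U \<subseteq> span W" using finite_subset sub by auto
  ultimately obtain C :: "'a vec set" where "int (card C) \<le> int (card W) - int (card U)"
    using replacement[OF _ W(1), of U] W(2) by auto
  then show ?thesis using rank_card_indpt[OF A U] by simp
qed

text \<open>Only earlier rows may be used, so the status of a row is unaffected by rows appended
  below it. Ranks of nested matrices can therefore be compared by counting rows.\<close>

definition row_dep :: "'a :: field mat \<Rightarrow> nat \<Rightarrow> bool" where
  "row_dep M i \<longleftrightarrow> (\<exists>c. \<forall>j<dim_col M. M $$ (i, j) = (\<Sum>l<i. c l * M $$ (l, j)))"

lemma card_less_Suc_filter:
  "card {i. i < Suc k \<and> P i} = card {i. i < k \<and> P i} + (if P k then 1 else 0)"
proof -
  have "{i. i < Suc k \<and> P i} = {i. i < k \<and> P i} \<union> (if P k then {k} else {})"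
    by (auto simp: less_Suc_eq)
  then show ?thesis by auto
qed

text \<open>Scanning from top to bottom, the rows not in the span of their predecessors stay
  independent and span everything seen so far. At the end they form a maximal independent set among
  the columns of the transpose.\<close>

lemma rank_transpose_eq_card_indep_rows:
  fixes M :: "'a :: field mat"
  assumes M: "M \<in> carrier_mat nr nc"
  shows "vec_space.rank nc (transpose_mat M) = card {i. i < nr \<and> \<not> row_dep M i}"
proof -
  interpret vec_space "TYPE('a)" nc .
  have row: "row M i \<in> carrier_vec nc" if "i < nr" for i using M that by auto
  have dep: "row_dep M i \<longleftrightarrow> row M i \<in> span (row M ` {..<i})" if "i < nr" for i
  proof -
    have "row M i \<in> span (row M ` {..<i}) \<longleftrightarrow>
        (\<exists>c. \<forall>j<nc. row M i $ j = (\<Sum>l<i. c l * row M l $ j))"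
      using that by (intro in_span_image_iff row) auto
    also have "\<dots> \<longleftrightarrow> row_dep M i"
      using M that by (auto simp: row_dep_def)
    finally show ?thesis ..
  qed
  define S where "S k = row M ` {i. i < k \<and> \<not> row_dep M i}" for k
  have S: "finite (S k)" "S k \<subseteq> carrier_vec nc" if "k \<le> nr" for k
    using that row by (auto simp: S_def)
  \<comment> \<open>The cardinality belongs to the invariant because \<open>row M\<close> need not
    be injective: a new row lies outside the current span, hence outside the set collected so
    far.\<close>
  have main: "lin_indpt (S k) \<and> card (S k) = card {i. i < k \<and> \<not> row_dep M i}
      \<and> span (S k) = span (row M ` {..<k})" if "k \<le> nr" for k
    using that
  proof (induction k)
    case 0
    then show ?case using lindep_span[of "{}"] by (simp add: S_def)
  next
    case (Suc k)
    then have IH: "lin_indpt (S k)" "card (S k) = card {i. i < k \<and> \<not> row_dep M i}"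
      "span (S k) = span (row M ` {..<k})" and k: "k < nr" by auto
    have sub: "row M ` {..<Suc k} \<subseteq> carrier_vec nc" using Suc.prems row by auto
    show ?case
    proof (cases "row_dep M k")
      case True
      have "{i. i < Suc k \<and> \<not> row_dep M i} = {i. i < k \<and> \<not> row_dep M i}"
        using True by (auto simp: less_Suc_eq)
      then have SS: "S (Suc k) = S k" by (simp add: S_def)
      have "row M ` {..<k} \<subseteq> span (row M ` {..<k})"
        using row k by (intro in_own_span) auto
      then have "row M ` {..<Suc k} \<subseteq> span (S k)"
        using True dep[OF k] unfolding IH(3) lessThan_Suc by blast
      then have "span (row M ` {..<Suc k}) \<subseteq> span (S k)"
        using S(2)[of k] k by (intro span_is_subset span_is_submodule) auto
      moreover have "span (S k) \<subseteq> span (row M ` {..<Suc k})"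
        unfolding IH(3) by (intro span_is_monotone) auto
      ultimately show ?thesis using IH True by (simp add: SS card_less_Suc_filter)
    next
      case False
      have SS: "S (Suc k) = S k \<union> {row M k}"
        using False by (auto simp: S_def less_Suc_eq)
      have nin: "row M k \<notin> span (S k)" using False dep[OF k] IH(3) by simp
      then have nin': "row M k \<notin> S k" using in_own_span[OF S(2)[of k]] k by auto
      have ind: "lin_indpt (S (Suc k))"
        unfolding SS using lin_dep_iff_in_span[OF S(2) IH(1) row nin'] nin k by simp
      have "span (S (Suc k)) \<subseteq> span (row M ` {..<Suc k})"
        by (intro span_is_monotone) (auto simp: S_def)
      moreover have "row M ` {..<Suc k} \<subseteq> span (S (Suc k))"
      proof -
        have "row M ` {..<k} \<subseteq> span (row M ` {..<k})"
          using sub by (intro in_own_span) (auto simp: lessThan_Suc)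
        also have "\<dots> \<subseteq> span (S (Suc k))"
          unfolding IH(3)[symmetric] SS by (intro span_is_monotone) auto
        finally have "row M ` {..<k} \<subseteq> span (S (Suc k))" .
        moreover have "S (Suc k) \<subseteq> span (S (Suc k))"
          using S(2)[of "Suc k"] k by (intro in_own_span) simp
        ultimately show ?thesis by (simp add: lessThan_Suc SS)
      qed
      then have "span (row M ` {..<Suc k}) \<subseteq> span (S (Suc k))"
        using S(2)[of "Suc k"] k by (intro span_is_subset span_is_submodule) auto
      ultimately show ?thesis
        using ind False IH(2) nin' S(1)[of k] k by (simp add: SS card_less_Suc_filter)
    qed
  qed
  have cols: "set (cols (transpose_mat M)) = row M ` {..<nr}"
    using M by (auto simp: rows_def)
  have "maximal (S nr) (\<lambda>T. T \<subseteq> set (cols (transpose_mat M)) \<and> lin_indpt T)"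
    unfolding maximal_def
  proof (intro conjI allI impI)
    show "S nr \<subseteq> set (cols (transpose_mat M))" unfolding cols by (auto simp: S_def)
    show "lin_indpt (S nr)" using main by simp
    fix T assume T: "S nr \<subseteq> T \<and> T \<subseteq> set (cols (transpose_mat M)) \<and> lin_indpt T"
    then have T_rows: "T \<subseteq> row M ` {..<nr}" unfolding cols by simp
    show "T = S nr"
    proof (rule ccontr)
      assume "T \<noteq> S nr"
      then obtain t where t: "t \<in> T" "t \<notin> S nr" using T by auto
      have "row M ` {..<nr} \<subseteq> span (row M ` {..<nr})"
        using row by (intro in_own_span) auto
      moreover have "t \<in> row M ` {..<nr}" using t(1) T_rows by (rule subsetD[rotated])
      ultimately have "t \<in> span (S nr)"
        using main[of nr] by (simp add: subset_iff)
      moreover have "t \<in> carrier_vec nc" using t(1) T_rows row by auto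
      ultimately have "lin_dep (S nr \<union> {t})"
        using lin_dep_iff_in_span[OF S(2)[of nr] _ _ t(2)] main[of nr] by simp
      moreover have "S nr \<union> {t} \<subseteq> T" using T t by auto
      ultimately show False using T subset_li_is_li by blast
    qed
  qed
  then show ?thesis
    using rank_card_indpt[of "transpose_mat M" nr] M main[of nr] by auto
qed

text \<open>Strong induction: in the relation for a dependent row, each predecessor is replaced by
  its own expansion over independent rows.\<close>

lemma row_eq_sum_indep_rows:
  fixes M :: "'a :: field mat"
  shows "\<exists>c. \<forall>j<dim_col M. M $$ (i, j) = (\<Sum>s \<in> {s. s \<le> i \<and> \<not> row_dep M s}. c s * M $$ (s, j))"
proof (induction i rule: less_induct)
  case (less i)
  let ?I = "\<lambda>i. {s. s \<le> i \<and> \<not> row_dep M s}"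
  have fin: "finite (?I i)" for i by simp
  show ?case
  proof (cases "row_dep M i")
    case False
    then have "(\<Sum>s \<in> ?I i. (if s = i then 1 else 0) * M $$ (s, j)) = M $$ (i, j)" for j
      using fin by (simp add: if_distrib[of "\<lambda>x. x * _"] cong: if_cong)
    then show ?thesis by (intro exI[of _ "\<lambda>s. if s = i then 1 else 0"]) simp
  next
    case True
    then obtain c where c: "\<And>j. j < dim_col M \<Longrightarrow> M $$ (i, j) = (\<Sum>l<i. c l * M $$ (l, j))"
      by (auto simp: row_dep_def)
    have "\<forall>l. \<exists>c. l < i \<longrightarrow> (\<forall>j<dim_col M. M $$ (l, j) = (\<Sum>s \<in> ?I l. c s * M $$ (s, j)))"
      using less by blast
    from choice[OF this] obtain P where P: "\<And>l j. l < i \<Longrightarrow> j < dim_col M \<Longrightarrow>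
        M $$ (l, j) = (\<Sum>s \<in> ?I l. P l s * M $$ (s, j))"
      by blast
    \<comment> \<open>The expansion of row \<open>l\<close> uses only rows up to \<open>l\<close>,
      so the coefficient of row \<open>s\<close> collects the contributions with
      \<open>s \<le> l\<close>.\<close>
    have "M $$ (i, j) = (\<Sum>s \<in> ?I i. (\<Sum>l<i. if s \<le> l then c l * P l s else 0) * M $$ (s, j))"
      if j: "j < dim_col M" for j
    proof -
      have "M $$ (i, j) = (\<Sum>l<i. \<Sum>s \<in> ?I l. c l * P l s * M $$ (s, j))"
      proof -
        have "c l * M $$ (l, j) = (\<Sum>s \<in> ?I l. c l * P l s * M $$ (s, j))" if "l < i" for l
          by (subst P[OF that j]) (simp add: sum_distrib_left mult.assoc)
        then show ?thesis unfolding c[OF j] by (intro sum.cong refl) simp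
      qed
      also have "\<dots> = (\<Sum>l<i. \<Sum>s \<in> ?I i. (if s \<le> l then c l * P l s else 0) * M $$ (s, j))"
        by (intro sum.cong refl sum.mono_neutral_cong_left) auto
      also have "\<dots> = (\<Sum>s \<in> ?I i. (\<Sum>l<i. if s \<le> l then c l * P l s else 0) * M $$ (s, j))"
        by (subst sum.swap) (simp add: sum_distrib_right)
      finally show ?thesis .
    qed
    then show ?thesis by (intro exI allI impI)
  qed
qed

text \<open>Expanding all rows over the independent ones factors \<open>M\<close> through a
  coefficient matrix with one column per independent row. Those columns, the set \<open>W\<close>,
  span all columns of \<open>M\<close>.\<close>

lemma rank_le_card_indep_rows:
  fixes M :: "'a :: field mat"
  assumes M: "M \<in> carrier_mat nr nc"
  shows "vec_space.rank nr M \<le> card {i. i < nr \<and> \<not> row_dep M i}"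
proof -
  interpret vec_space "TYPE('a)" nr .
  let ?I = "{i. i < nr \<and> \<not> row_dep M i}"
  have "\<exists>c. \<forall>j<nc. M $$ (i, j) = (\<Sum>s \<in> ?I. c s * M $$ (s, j))" if "i < nr" for i
  proof -
    obtain c where c: "\<forall>j<nc. M $$ (i, j) = (\<Sum>s \<in> {s. s \<le> i \<and> \<not> row_dep M s}. c s * M $$ (s, j))"
      using row_eq_sum_indep_rows[of M i] M by auto
    have "(\<Sum>s \<in> {s. s \<le> i \<and> \<not> row_dep M s}. c s * M $$ (s, j)) =
        (\<Sum>s \<in> ?I. (if s \<le> i then c s else 0) * M $$ (s, j))" for j
      using that by (intro sum.mono_neutral_cong_left) auto
    then show ?thesis using c by (intro exI[of _ "\<lambda>s. if s \<le> i then c s else 0"]) simp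
  qed
  then have "\<forall>i. \<exists>c. i < nr \<longrightarrow> (\<forall>j<nc. M $$ (i, j) = (\<Sum>s \<in> ?I. c s * M $$ (s, j)))"
    by blast
  from choice[OF this] obtain c where c:
    "\<And>i j. i < nr \<Longrightarrow> j < nc \<Longrightarrow> M $$ (i, j) = (\<Sum>s \<in> ?I. c i s * M $$ (s, j))"
    by blast
  define W where "W = (\<lambda>s. vec nr (\<lambda>i. c i s)) ` ?I"
  have W: "finite W" "W \<subseteq> carrier_vec nr" by (auto simp: W_def)
  have "col M j \<in> span W" if j: "j < nc" for j
  proof -
    define r where "r = card ?I"
    \<comment> \<open>The independent row indices are renumbered as an initial segment, the form
      that \<open>in_span_image_iff\<close> takes.\<close>
    obtain h where h: "bij_betw h {..<r} ?I"
      using ex_bij_betw_nat_finite[of ?I] by (auto simp: r_def atLeast0LessThan)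
    have Wh: "W = (\<lambda>l. vec nr (\<lambda>i. c i (h l))) ` {..<r}"
      unfolding W_def bij_betw_imp_surj_on[OF h, symmetric] image_image ..
    have "col M j $ i = (\<Sum>l<r. M $$ (h l, j) * vec nr (\<lambda>i. c i (h l)) $ i)" if i: "i < nr" for i
      using M i j by (simp add: c[OF i j] sum.reindex_bij_betw[OF h, symmetric] mult.commute)
    then show ?thesis
      unfolding Wh using M j by (subst in_span_image_iff) auto
  qed
  then have "set (cols M) \<subseteq> span W" using M by (auto simp: cols_def)
  then have "rank M \<le> card W" by (intro rank_le_card_span[OF M W])
  also have "\<dots> \<le> card ?I" unfolding W_def by (intro card_image_le) auto
  finally show ?thesis .
qed

text \<open>The upper bound for \<open>M\<close> and for its transpose, together with the exact
  count for the rank of a transpose, closes a circle of inequalities.\<close>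

lemma rank_eq_card_indep_rows:
  fixes M :: "'a :: field mat"
  assumes M: "M \<in> carrier_mat nr nc"
  shows "vec_space.rank nr M = card {i. i < nr \<and> \<not> row_dep M i}"
proof (rule antisym[OF rank_le_card_indep_rows[OF M]])
  have M': "transpose_mat M \<in> carrier_mat nc nr" using M by simp
  have "card {i. i < nr \<and> \<not> row_dep M i} = vec_space.rank nc (transpose_mat M)"
    using rank_transpose_eq_card_indep_rows[OF M] ..
  also have "\<dots> \<le> card {i. i < nc \<and> \<not> row_dep (transpose_mat M) i}"
    by (rule rank_le_card_indep_rows[OF M'])
  also have "\<dots> = vec_space.rank nr M"
    using rank_transpose_eq_card_indep_rows[OF M'] by simp
  finally show "card {i. i < nr \<and> \<not> row_dep M i} \<le> vec_space.rank nr M" .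
qed

section \<open>Auxiliary facts on sums, counting and powers\<close>

lemma sum_lessThan_add:
  fixes f :: "nat \<Rightarrow> 'a :: comm_monoid_add"
  shows "sum f {..<a + b} = sum f {..<a} + (\<Sum>l<b. f (a + l))"
  by (induction b) (simp_all add: add.assoc)

lemma card_filter_less_add:
  "card {i. i < a + b \<and> P i} = card {i. i < a \<and> P i} + card {j. j < b \<and> P (a + j)}"
  for a b :: nat
  by (induction b) (simp_all add: card_less_Suc_filter)

text \<open>Advancing time by one turns delay \<open>i\<close> into delay \<open>i + 1\<close>: the
  coefficients move up by one block of length \<open>p\<close>, and the vacated first block is
  filled with 0.\<close>

lemma sum_block_shift:
  fixes f :: "nat \<Rightarrow> nat \<Rightarrow> 'a :: semiring_0"
  assumes "p > 0"
  shows "(\<Sum>l<p + N. (if l < p then 0 else c (l - p)) * f (l mod p) (t + l div p))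
    = (\<Sum>l<N. c l * f (l mod p) (Suc t + l div p))"
  using assms by (simp add: sum_lessThan_add)

lemma row_dep_cong:
  assumes "dim_col M = dim_col N" "\<And>l j. l \<le> i \<Longrightarrow> j < dim_col M \<Longrightarrow> M $$ (l, j) = N $$ (l, j)"
  shows "row_dep M i \<longleftrightarrow> row_dep N i"
  unfolding row_dep_def using assms by simp

lemma pow_mat_Suc_left:
  assumes "A \<in> carrier_mat n n" shows "A ^\<^sub>m Suc i = A * A ^\<^sub>m i"
proof (induction i)
  case 0
  then show ?case using assms by simp
next
  case (Suc i)
  have "A ^\<^sub>m Suc (Suc i) = A * A ^\<^sub>m i * A" by (simp only: pow_mat.simps(2)[of A "Suc i"] Suc)
  also have "\<dots> = A * A ^\<^sub>m Suc i"
    using assms by (simp add: assoc_mult_mat[of _ n n _ n _ n])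
  finally show ?case .
qed

section \<open>Dependence between the rows of the data Hankel matrices\<close>

locale io_data =
  fixes m p T :: nat and u y :: "real mat"
  assumes m: "m > 0" and p: "p > 0"
    and u: "u \<in> carrier_mat m T" and y: "y \<in> carrier_mat p T" and u_nonzero: "u \<noteq> 0\<^sub>m m T"
begin

lemma dims [simp]: "dim_row u = m" "dim_col u = T" "dim_row y = p" "dim_col y = T"
  using u y by auto

text \<open>
  In the sums below the index \<open>l\<close> stands for component \<open>l mod m\<close> (or \<open>l mod p\<close>) at delay \<open>l div m\<close>
  (or \<open>l div p\<close>), so that \<open>l < k * p + j\<close> ranges over the output rows before \<open>(k, j)\<close>.
\<close>

definition input_lin :: "nat \<Rightarrow> (nat \<Rightarrow> real) \<Rightarrow> bool" where
  "input_lin k f \<longleftrightarrow> (\<exists>a. \<forall>t. t + k < T \<longrightarrow>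
     f t = (\<Sum>l<(k + 1) * m. a l * u $$ (l mod m, t + l div m)))"

text \<open>For \<open>j < p\<close> and \<open>k < T\<close> this is \<open>row_dep\<close> of
  \<open>H_mat u y k\<close> at the row of output \<open>j\<close> at delay \<open>k\<close>. The
  input coefficients are hidden in \<open>input_lin\<close>, so that later arguments can be carried
  out modulo inputs.\<close>

definition output_dep :: "nat \<Rightarrow> nat \<Rightarrow> bool" where
  "output_dep k j \<longleftrightarrow> (\<exists>c. input_lin k (\<lambda>t. y $$ (j, t + k)
     - (\<Sum>l<k * p + j. c l * y $$ (l mod p, t + l div p))))"

lemma input_lin_cong: "input_lin k f \<Longrightarrow> (\<And>t. t + k < T \<Longrightarrow> f t = g t) \<Longrightarrow> input_lin k g"
  unfolding input_lin_def by metis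

lemma input_lin_zero: "input_lin k (\<lambda>t. 0)"
  unfolding input_lin_def by (intro exI[of _ "\<lambda>l. 0"]) simp

lemma input_lin_add:
  assumes "input_lin k f" "input_lin k g" shows "input_lin k (\<lambda>t. f t + g t)"
proof -
  obtain a b where "\<And>t. t + k < T \<Longrightarrow> f t = (\<Sum>l<(k + 1) * m. a l * u $$ (l mod m, t + l div m))"
    "\<And>t. t + k < T \<Longrightarrow> g t = (\<Sum>l<(k + 1) * m. b l * u $$ (l mod m, t + l div m))"
    using assms unfolding input_lin_def by blast
  then show ?thesis
    unfolding input_lin_def by (intro exI[of _ "\<lambda>l. a l + b l"]) (simp add: distrib_right sum.distrib)
qed

lemma input_lin_cmult:
  assumes "input_lin k f" shows "input_lin k (\<lambda>t. c * f t)"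
proof -
  obtain a where "\<And>t. t + k < T \<Longrightarrow> f t = (\<Sum>l<(k + 1) * m. a l * u $$ (l mod m, t + l div m))"
    using assms unfolding input_lin_def by blast
  then show ?thesis
    unfolding input_lin_def by (intro exI[of _ "\<lambda>l. c * a l"]) (simp add: sum_distrib_left mult.assoc)
qed

lemma input_lin_diff: "input_lin k f \<Longrightarrow> input_lin k g \<Longrightarrow> input_lin k (\<lambda>t. f t - g t)"
  using input_lin_add[OF _ input_lin_cmult[of k g "-1"], of f] by simp

lemma input_lin_sum:
  assumes "\<And>s. s \<in> S \<Longrightarrow> input_lin k (f s)" shows "input_lin k (\<lambda>t. \<Sum>s\<in>S. f s t)"
  using assms by (induction S rule: infinite_finite_induct) (auto intro: input_lin_add input_lin_zero)

lemma input_lin_input: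
  assumes "a < m" "s \<le> k" shows "input_lin k (\<lambda>t. u $$ (a, t + s))"
proof -
  let ?l = "s * m + a"
  have "?l < (k + 1) * m"
  proof -
    have "s * m + a < (s + 1) * m" using assms by simp
    also have "\<dots> \<le> (k + 1) * m" using assms by (intro mult_le_mono1) simp
    finally show ?thesis .
  qed
  moreover have "?l mod m = a" "?l div m = s" using assms by auto
  ultimately show ?thesis
    unfolding input_lin_def
    by (intro exI[of _ "\<lambda>l. if l = ?l then 1 else 0"])
      (simp add: if_distrib[of "\<lambda>x. x * _"] cong: if_cong)
qed

text \<open>The relation at time \<open>t + 1\<close> is a relation at delay \<open>k + 1\<close>
  and time \<open>t\<close>, whose coefficients at delay 0 vanish.\<close>

lemma output_dep_Suc:
  assumes "output_dep k j" shows "output_dep (Suc k) j"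
proof -
  obtain c a where *: "y $$ (j, t + k) - (\<Sum>l<k * p + j. c l * y $$ (l mod p, t + l div p))
      = (\<Sum>l<(k + 1) * m. a l * u $$ (l mod m, t + l div m))" if "t + k < T" for t
    using assms unfolding output_dep_def input_lin_def by blast
  have "y $$ (j, t + Suc k)
      - (\<Sum>l<Suc k * p + j. (if l < p then 0 else c (l - p)) * y $$ (l mod p, t + l div p))
      = (\<Sum>l<(Suc k + 1) * m. (if l < m then 0 else a (l - m)) * u $$ (l mod m, t + l div m))"
    if "t + Suc k < T" for t
    using that *[of "Suc t"] sum_block_shift[OF p, where f = "\<lambda>i j. y $$ (i, j)" and N = "k * p + j"]
      sum_block_shift[OF m, where f = "\<lambda>i j. u $$ (i, j)" and N = "(k + 1) * m"]
    by (simp add: add.assoc)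
  then show ?thesis
    unfolding output_dep_def input_lin_def
    by (intro exI[of _ "\<lambda>l. if l < p then 0 else c (l - p)"]
        exI[of _ "\<lambda>l. if l < m then 0 else a (l - m)"] allI impI)
qed

lemma output_dep_mono:
  assumes "k \<le> k'" "output_dep k j" shows "output_dep k' j"
  using assms by (induction k' rule: dec_induct) (simp_all add: output_dep_Suc)

lemma T_pos: "T > 0"
proof (rule ccontr)
  assume "\<not> T > 0"
  then have "u = 0\<^sub>m m T" using u by (intro eq_matI) auto
  then show False using u_nonzero by simp
qed

text \<open>At delay \<open>T - 1\<close> the Hankel matrix has a single column,
  \<open>t = 0\<close>, and one nonzero input entry already spans every row. The factor used is the
  quotient of the two entries.\<close>

lemma output_dep_last: "output_dep (T - 1) j"
proof -
  obtain a s where as: "a < m" "s < T" "u $$ (a, s) \<noteq> 0"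
  proof -
    have "\<exists>a<m. \<exists>s<T. u $$ (a, s) \<noteq> 0"
    proof (rule ccontr)
      assume "\<not> ?thesis"
      then have "u = 0\<^sub>m m T" by (intro eq_matI) auto
      then show False using u_nonzero by simp
    qed
    then show ?thesis using that by blast
  qed
  have "input_lin (T - 1) (\<lambda>t. y $$ (j, T - 1) / u $$ (a, s) * u $$ (a, t + s))"
    using as by (intro input_lin_cmult input_lin_input) auto
  then have "input_lin (T - 1) (\<lambda>t. y $$ (j, t + (T - 1)))"
  proof (rule input_lin_cong)
    fix t assume "t + (T - 1) < T"
    then have "t = 0" by simp
    then show "y $$ (j, T - 1) / u $$ (a, s) * u $$ (a, t + s) = y $$ (j, t + (T - 1))"
      using as by simp
  qed
  then show ?thesis
    unfolding output_dep_def by (intro exI[of _ "\<lambda>l. 0"]) simp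
qed

text \<open>\<open>G_mat\<close> consists of the first rows of \<open>H_mat\<close>, whose status is
  the same in both matrices. The difference of the ranks thus counts the new rows in the last block
  of \<open>p\<close> rows.\<close>

lemma delta_eq:
  assumes k: "k < T"
  shows "delta u y k = int (card {j. j < p \<and> \<not> output_dep k j})"
proof -
  let ?H = "H_mat u y k" and ?G = "G_mat u y k"
  let ?M = "(k + 1) * m"
  let ?N = "?M + k * p"
  have H: "?H \<in> carrier_mat (?N + p) (T - k)"
    by (auto simp: H_mat_def hankel_def append_rows_def)
  have G: "?G \<in> carrier_mat ?N (T - k)"
    using H by (auto simp: G_mat_def)
  have Hu: "?H $$ (l, t) = u $$ (l mod m, t + l div m)" if "l < ?M" "t + k < T" for l t
    using that by (simp add: H_mat_def hankel_def append_rows_def add.commute)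
  have Hy: "?H $$ (?M + l, t) = y $$ (l mod p, t + l div p)" if "l < (k + 1) * p" "t + k < T" for l t
    using that by (simp add: H_mat_def hankel_def append_rows_def add.commute)
  have Hy': "?H $$ (?N + j, t) = y $$ (j, t + k)" if "j < p" "t + k < T" for j t
    using Hy[of "k * p + j" t] that by (simp add: add.assoc)
  have "row_dep ?H (?N + j) \<longleftrightarrow> output_dep k j" if j: "j < p" for j
  proof -
    have split: "(\<Sum>l<?N + j. c l * ?H $$ (l, t)) =
        (\<Sum>l<?M. c l * u $$ (l mod m, t + l div m))
        + (\<Sum>l<k * p + j. c (?M + l) * y $$ (l mod p, t + l div p))" if "t + k < T" for c t
    proof -
      have "?H $$ (?M + l, t) = y $$ (l mod p, t + l div p)" if "l < k * p + j" for l
        using that \<open>t + k < T\<close> j by (intro Hy) auto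
      then show ?thesis
        unfolding add.assoc[of ?M] sum_lessThan_add[of _ ?M]
        using that by (intro arg_cong2[of _ _ _ _ "(+)"] sum.cong refl) (simp_all add: Hu)
    qed
    have t: "t < T - k \<longleftrightarrow> t + k < T" for t by auto
    show ?thesis
    proof
      assume "row_dep ?H (?N + j)"
      then obtain c where "\<forall>t. t + k < T \<longrightarrow> y $$ (j, t + k) =
        (\<Sum>l<?M. c l * u $$ (l mod m, t + l div m))
        + (\<Sum>l<k * p + j. c (?M + l) * y $$ (l mod p, t + l div p))"
        using H Hy'[OF j] split unfolding row_dep_def by (auto simp: t)
      then show "output_dep k j" unfolding output_dep_def input_lin_def
        by (intro exI[of _ "\<lambda>l. c (?M + l)"] exI[of _ c]) simp
    next
      assume "output_dep k j"
      then obtain c a where ca: "\<forall>t. t + k < T \<longrightarrow> y $$ (j, t + k)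
         - (\<Sum>l<k * p + j. c l * y $$ (l mod p, t + l div p))
         = (\<Sum>l<?M. a l * u $$ (l mod m, t + l div m))"
        unfolding output_dep_def input_lin_def by blast
      let ?c = "\<lambda>l. if l < ?M then a l else c (l - ?M)"
      have "?H $$ (?N + j, t) = (\<Sum>l<?N + j. ?c l * ?H $$ (l, t))" if "t + k < T" for t
      proof -
        have "(\<Sum>l<?N + j. ?c l * ?H $$ (l, t)) = (\<Sum>l<?M. a l * u $$ (l mod m, t + l div m))
            + (\<Sum>l<k * p + j. c l * y $$ (l mod p, t + l div p))"
          unfolding split[OF that] by (intro arg_cong2[of _ _ _ _ "(+)"] sum.cong refl) simp_all
        moreover have "y $$ (j, t + k) - (\<Sum>l<k * p + j. c l * y $$ (l mod p, t + l div p))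
            = (\<Sum>l<?M. a l * u $$ (l mod m, t + l div m))"
          using ca that by blast
        ultimately show ?thesis using Hy'[OF j that] by linarith
      qed
      then show "row_dep ?H (?N + j)"
        unfolding row_dep_def using H by (intro exI[of _ ?c]) (auto simp: t)
    qed
  qed
  moreover have "row_dep ?G i \<longleftrightarrow> row_dep ?H i" if "i < ?N" for i
    using that H G by (intro row_dep_cong) (auto simp: G_mat_def)
  then have "mrank ?G = card {i. i < ?N \<and> \<not> row_dep ?H i}"
    using rank_eq_card_indep_rows[OF G] carrier_matD(1)[OF G] by (simp cong: conj_cong)
  moreover have "mrank ?H = card {i. i < ?N + p \<and> \<not> row_dep ?H i}"
    using rank_eq_card_indep_rows[OF H] carrier_matD(1)[OF H] by simp
  ultimately show ?thesis
    unfolding delta_def by (simp add: card_filter_less_add cong: conj_cong)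
qed

text \<open>Modulo inputs, the output at time \<open>t + i\<close> is
  \<open>C * A ^\<^sub>m i\<close> applied to the state at time \<open>t\<close>. A relation between
  rows of the observability matrix therefore cancels the state and leaves a relation between data
  rows.\<close>

lemma output_dep_of_row_dep_obs:
  assumes A: "A \<in> carrier_mat n n" and B: "B \<in> carrier_mat n m"
    and C: "C \<in> carrier_mat p n" and D: "D \<in> carrier_mat p m"
    and ex: "explains u y (A, B, C, D)" and j: "j < p"
    and dep: "row_dep (obs_mat (Suc k) C A) (k * p + j)"
  shows "output_dep k j"
proof -
  obtain X where X: "X \<in> carrier_mat n (T + 1)"
    and eqs: "\<And>t. t < T \<Longrightarrow> col X (t + 1) = A *\<^sub>v col X t + B *\<^sub>v col u t"
      "\<And>t. t < T \<Longrightarrow> col y t = C *\<^sub>v col X t + D *\<^sub>v col u t"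
    using ex A by auto
  have state: "X $$ (r, Suc t) = (\<Sum>s<n. A $$ (r, s) * X $$ (s, t)) + (\<Sum>a<m. B $$ (r, a) * u $$ (a, t))"
    if "r < n" "t < T" for r t
    using arg_cong[OF eqs(1)[OF that(2)], of "\<lambda>v. v $ r"] that A B X u
    by (simp add: scalar_prod_def atLeast0LessThan)
  have out: "y $$ (b, t) = (\<Sum>s<n. C $$ (b, s) * X $$ (s, t)) + (\<Sum>a<m. D $$ (b, a) * u $$ (a, t))"
    if "b < p" "t < T" for b t
    using arg_cong[OF eqs(2)[OF that(2)], of "\<lambda>v. v $ b"] that C D X u y
    by (simp add: scalar_prod_def atLeast0LessThan)
  have mult: "(P * A ^\<^sub>m i) $$ (r, c) = (\<Sum>s<n. P $$ (r, s) * (A ^\<^sub>m i) $$ (s, c))"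
    if "P \<in> carrier_mat q n" "r < q" "c < n" for P q i r c
    using that A pow_carrier_mat[OF A, of i] by (simp add: scalar_prod_def atLeast0LessThan)
  have linear: "(\<Sum>s<n. v s * (X $$ (s, t') - (\<Sum>c<n. M $$ (s, c) * X $$ (c, t))))
      = (\<Sum>s<n. v s * X $$ (s, t')) - (\<Sum>c<n. (\<Sum>s<n. v s * M $$ (s, c)) * X $$ (c, t))"
    for v M t t'
    by (simp add: right_diff_distrib sum_subtractf sum_distrib_left sum_distrib_right mult.assoc
        sum.swap[of "\<lambda>s c. v s * (M $$ (s, c) * X $$ (c, t))"])
  \<comment> \<open>Variation of constants, keeping only the fact that the remainder is a
    combination of inputs at delays up to \<open>k\<close>.\<close>
  have evol: "input_lin k (\<lambda>t. X $$ (r, t + i) - (\<Sum>c<n. (A ^\<^sub>m i) $$ (r, c) * X $$ (c, t)))"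
    if "i \<le> k" "r < n" for i r
    using that
  proof (induction i arbitrary: r)
    case 0
    have "(\<Sum>c<n. (A ^\<^sub>m 0) $$ (r, c) * X $$ (c, t)) = X $$ (r, t)" for t
      using 0 A by (simp add: if_distrib[of "\<lambda>x. x * _"] cong: if_cong)
    then show ?case by (simp add: input_lin_zero)
  next
    case (Suc i)
    have pow: "A ^\<^sub>m Suc i = A * A ^\<^sub>m i"
      using A by (rule pow_mat_Suc_left)
    have "input_lin k (\<lambda>t. (\<Sum>s<n. A $$ (r, s) * (X $$ (s, t + i) - (\<Sum>c<n. (A ^\<^sub>m i) $$ (s, c) * X $$ (c, t))))
       + (\<Sum>a<m. B $$ (r, a) * u $$ (a, t + i)))"
      using Suc by (intro input_lin_add input_lin_sum input_lin_cmult input_lin_input) auto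
    then show ?case
      by (rule input_lin_cong) (use Suc.prems A in \<open>simp add: linear pow mult state del: pow_mat.simps index_mult_mat(1)\<close>)
  qed
  have obs: "input_lin k (\<lambda>t. y $$ (b, t + i) - (\<Sum>c<n. (C * A ^\<^sub>m i) $$ (b, c) * X $$ (c, t)))"
    if "i \<le> k" "b < p" for i b
  proof -
    have "input_lin k (\<lambda>t. (\<Sum>s<n. C $$ (b, s) * (X $$ (s, t + i) - (\<Sum>c<n. (A ^\<^sub>m i) $$ (s, c) * X $$ (c, t))))
       + (\<Sum>a<m. D $$ (b, a) * u $$ (a, t + i)))"
      using evol that by (intro input_lin_add input_lin_sum input_lin_cmult input_lin_input) auto
    then show ?thesis
      by (rule input_lin_cong) (use that C in \<open>simp add: linear mult out del: index_mult_mat(1)\<close>)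
  qed
  let ?O = "obs_mat (Suc k) C A"
  obtain c where c: "\<And>s. s < n \<Longrightarrow> ?O $$ (k * p + j, s) = (\<Sum>l<k * p + j. c l * ?O $$ (l, s))"
    using dep C unfolding row_dep_def by (auto simp: obs_mat_def)
  have O: "?O $$ (l, s) = (C * A ^\<^sub>m (l div p)) $$ (l mod p, s)" if "l < Suc k * p" "s < n" for l s
    using that C by (simp add: obs_mat_def)
  have top: "(C * A ^\<^sub>m k) $$ (j, s) = (\<Sum>l<k * p + j. c l * (C * A ^\<^sub>m (l div p)) $$ (l mod p, s))"
    if "s < n" for s
  proof -
    have "(C * A ^\<^sub>m k) $$ (j, s) = ?O $$ (k * p + j, s)" using O[of "k * p + j" s] that j by simp
    also have "\<dots> = (\<Sum>l<k * p + j. c l * (C * A ^\<^sub>m (l div p)) $$ (l mod p, s))"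
      unfolding c[OF that] using j that by (intro sum.cong refl) (simp add: O)
    finally show ?thesis .
  qed
  have le: "l div p \<le> k" if "l < k * p + j" for l
  proof -
    have "l < Suc k * p" using that j by simp
    then show ?thesis using less_mult_imp_div_less less_Suc_eq_le by blast
  qed
  \<comment> \<open>The coefficients \<open>c\<close> of the dependence are applied to the output
    remainders of \<open>obs\<close>; by \<open>top\<close> the state terms then cancel.\<close>
  have "input_lin k (\<lambda>t. (y $$ (j, t + k) - (\<Sum>s<n. (C * A ^\<^sub>m k) $$ (j, s) * X $$ (s, t)))
     - (\<Sum>l<k * p + j. c l * (y $$ (l mod p, t + l div p)
         - (\<Sum>s<n. (C * A ^\<^sub>m (l div p)) $$ (l mod p, s) * X $$ (s, t)))))"
    using j p by (intro input_lin_diff input_lin_sum input_lin_cmult obs le) auto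
  then have "input_lin k (\<lambda>t. y $$ (j, t + k) - (\<Sum>l<k * p + j. c l * y $$ (l mod p, t + l div p)))"
  proof (rule input_lin_cong)
    fix t
    have "(\<Sum>s<n. (C * A ^\<^sub>m k) $$ (j, s) * X $$ (s, t)) = (\<Sum>l<k * p + j. c l *
        (\<Sum>s<n. (C * A ^\<^sub>m (l div p)) $$ (l mod p, s) * X $$ (s, t)))"
      by (simp add: top sum_distrib_left sum_distrib_right mult.assoc) (rule sum.swap)
    then show "(y $$ (j, t + k) - (\<Sum>s<n. (C * A ^\<^sub>m k) $$ (j, s) * X $$ (s, t)))
     - (\<Sum>l<k * p + j. c l * (y $$ (l mod p, t + l div p)
         - (\<Sum>s<n. (C * A ^\<^sub>m (l div p)) $$ (l mod p, s) * X $$ (s, t)))) =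
     y $$ (j, t + k) - (\<Sum>l<k * p + j. c l * y $$ (l mod p, t + l div p))"
      by (simp add: right_diff_distrib sum_subtractf)
  qed
  then show ?thesis unfolding output_dep_def by blast
qed

end

section \<open>Realization of difference equations\<close>

lemma sum_blocks:
  fixes f :: "nat \<Rightarrow> 'a :: comm_monoid_add"
  shows "sum f {..<k * p} = (\<Sum>i<k. \<Sum>b<p. f (i * p + b))"
  by (induction k) (simp_all add: sum_lessThan_add add.commute[of p])

text \<open>Forward substitution in a unit lower triangular system. Solutions of finite prefixes
  agree where both are defined, so their diagonal solves the whole system.\<close>

lemma triangular_solution:
  fixes g :: "nat \<Rightarrow> 'a :: comm_semiring_0"
  shows "\<exists>c. \<forall>j. c j = g j + (\<Sum>b<j. \<gamma> j b * c b)"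
proof -
  have "\<exists>c. \<forall>j<N. c j = g j + (\<Sum>b<j. \<gamma> j b * c b)" for N
  proof (induction N)
    case (Suc N)
    then obtain c where c: "\<forall>j<N. c j = g j + (\<Sum>b<j. \<gamma> j b * c b)" by blast
    have "(\<Sum>b<j. \<gamma> j b * (c(N := v)) b) = (\<Sum>b<j. \<gamma> j b * c b)" if "j \<le> N" for j v
      using that by (intro sum.cong) auto
    then show ?case
      using c by (intro exI[of _ "c(N := g N + (\<Sum>b<N. \<gamma> N b * c b))"]) (simp add: less_Suc_eq)
  qed simp
  then have "\<forall>N. \<exists>c. \<forall>j<N. c j = g j + (\<Sum>b<j. \<gamma> j b * c b)" by blast
  from choice[OF this] obtain c where c: "\<And>N j. j < N \<Longrightarrow> c N j = g j + (\<Sum>b<j. \<gamma> j b * c N b)"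
    by blast
  have eq: "c N j = c (Suc j) j" if "j < N" for N j
    using that
  proof (induction j arbitrary: N rule: less_induct)
    case (less j)
    have "c N b = c (Suc j) b" if "b < j" for b
      using less.IH[OF that, of N] less.IH[OF that, of "Suc j"] that less.prems by simp
    then show ?case using c[OF less.prems] c[of j "Suc j"] by simp
  qed
  have "c (Suc j) j = g j + (\<Sum>b<j. \<gamma> j b * c (Suc b) b)" for j
  proof -
    have "(\<Sum>b<j. \<gamma> j b * c (Suc j) b) = (\<Sum>b<j. \<gamma> j b * c (Suc b) b)"
      by (intro sum.cong refl arg_cong[of _ _ "(*) _"] eq) simp
    then show ?thesis using c[of j "Suc j"] by simp
  qed
  then show ?thesis by (intro exI[of _ "\<lambda>j. c (Suc j) j"] allI)
qed

text \<open>Here \<open>g j i t\<close> is what the samples at time \<open>t\<close> contribute to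
  \<open>y j\<close> at time \<open>t + (d j - i)\<close>. By \<open>leading\<close>, output
  \<open>j\<close> depends at the same time only on outputs before \<open>j\<close>, so the present
  outputs can be computed from the state and the input.\<close>

lemma realization:
  fixes m p T :: nat and d :: "nat \<Rightarrow> nat" and \<alpha> \<beta> :: "nat \<Rightarrow> nat \<Rightarrow> nat \<Rightarrow> real" and u y :: "nat \<Rightarrow> nat \<Rightarrow> real"
  defines "g \<equiv> \<lambda>j i t. (\<Sum>b<p. \<beta> j i b * y b t) + (\<Sum>s<m. \<alpha> j i s * u s t)"
  assumes leading: "\<And>j b. j < p \<Longrightarrow> j \<le> b \<Longrightarrow> \<beta> j (d j) b = 0"
    and rel: "\<And>j t. j < p \<Longrightarrow> t + d j < T \<Longrightarrow> y j (t + d j) = (\<Sum>i\<le>d j. g j i (t + i))"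
  shows "\<exists>A B C D x. A \<in> carrier_mat (\<Sum>j<p. d j) (\<Sum>j<p. d j) \<and> B \<in> carrier_mat (\<Sum>j<p. d j) m
    \<and> C \<in> carrier_mat p (\<Sum>j<p. d j) \<and> D \<in> carrier_mat p m
    \<and> (\<forall>t<T. \<forall>r<(\<Sum>j<p. d j). x (Suc t) r =
        (\<Sum>k<(\<Sum>j<p. d j). A $$ (r, k) * x t k) + (\<Sum>s<m. B $$ (r, s) * u s t))
    \<and> (\<forall>t<T. \<forall>b<p. y b t =
        (\<Sum>k<(\<Sum>j<p. d j). C $$ (b, k) * x t k) + (\<Sum>s<m. D $$ (b, s) * u s t))"
proof -
  \<comment> \<open>The state \<open>(j, r)\<close> is the part of \<open>y\<^sub>j(t + r)\<close> that is not due to \<open>u\<close> and \<open>y\<close> from time \<open>t\<close> on;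
    see \<open>state_ok\<close>. The pairs are enumerated by \<open>f\<close> to obtain matrices.\<close>
  define S where "S = Sigma {..<p} (\<lambda>j. {..<d j})"
  define n where "n = (\<Sum>j<p. d j)"
  have S: "finite S" "card S = n" by (auto simp: S_def n_def)
  obtain f where f: "bij_betw f {..<n} S"
    using ex_bij_betw_nat_finite[OF S(1)] S(2) by (auto simp: atLeast0LessThan)
  \<comment> \<open>Output \<open>j\<close> reads state \<open>(j, 0)\<close> and the earlier
    outputs. Eliminating the latter gives \<open>c\<close> as the entries of the matrix
    \<open>C\<close>, and in the same way \<open>e\<close> as those of \<open>D\<close>.\<close>
  have "\<forall>\<sigma> :: nat \<times> nat. \<exists>c. \<forall>j. c j = (if \<sigma> = (j, 0) then 1 else 0) + (\<Sum>b<j. \<beta> j (d j) b * c b)"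
    by (intro allI triangular_solution)
  from choice[OF this] obtain c' :: "nat \<times> nat \<Rightarrow> nat \<Rightarrow> real" where "\<forall>\<sigma> j. c' \<sigma> j = (if \<sigma> = (j, 0) then 1 else 0)
      + (\<Sum>b<j. \<beta> j (d j) b * c' \<sigma> b)" ..
  then obtain c :: "nat \<Rightarrow> nat \<times> nat \<Rightarrow> real" where c: "\<And>\<sigma> j. c j \<sigma> = (if \<sigma> = (j, 0) then 1 else 0)
      + (\<Sum>b<j. \<beta> j (d j) b * c b \<sigma>)" by (intro that[of "\<lambda>j \<sigma>. c' \<sigma> j"]) (elim allE)
  have "\<forall>s. \<exists>e. \<forall>j. e j = \<alpha> j (d j) s + (\<Sum>b<j. \<beta> j (d j) b * e b)"
    by (intro allI triangular_solution)
  from choice[OF this] obtain e' where "\<forall>s j. e' s j = \<alpha> j (d j) s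
      + (\<Sum>b<j. \<beta> j (d j) b * e' s b)" ..
  then obtain e where e: "\<And>s j. e j s = \<alpha> j (d j) s
      + (\<Sum>b<j. \<beta> j (d j) b * e b s)" by (intro that[of "\<lambda>j s. e' s j"]) (elim allE)
  define out where "out X U j = (\<Sum>\<sigma>\<in>S. c j \<sigma> * X \<sigma>) + (\<Sum>s<m. e j s * U s)"
    for X :: "nat \<times> nat \<Rightarrow> real" and U j
  have delta_sum: "(\<Sum>\<tau>\<in>S. (if \<tau> = \<sigma> then 1 else 0) * X \<tau>) = (if \<sigma> \<in> S then X \<sigma> else 0)"
    for \<sigma> and X :: "nat \<times> nat \<Rightarrow> real"
    using S(1) by (simp add: if_distrib[of "\<lambda>x. x * _"] cong: if_cong)
  have out: "out X U j = (if (j, 0) \<in> S then X (j, 0) else 0)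
      + (\<Sum>b<j. \<beta> j (d j) b * out X U b) + (\<Sum>s<m. \<alpha> j (d j) s * U s)" for X U j
  proof -
    have 1: "(\<Sum>\<sigma>\<in>S. c j \<sigma> * X \<sigma>) = (if (j, 0) \<in> S then X (j, 0) else 0)
        + (\<Sum>b<j. \<beta> j (d j) b * (\<Sum>\<sigma>\<in>S. c b \<sigma> * X \<sigma>))"
      by (subst c) (simp add: distrib_right sum.distrib delta_sum sum_distrib_left sum_distrib_right
          mult.assoc sum.swap[of _ S])
    have 2: "(\<Sum>s<m. e j s * U s) = (\<Sum>s<m. \<alpha> j (d j) s * U s)
        + (\<Sum>b<j. \<beta> j (d j) b * (\<Sum>s<m. e b s * U s))"
      by (subst e) (simp add: distrib_right sum.distrib sum_distrib_left sum_distrib_right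
          mult.assoc sum.swap[of _ "{..<m}"])
    show ?thesis
      unfolding out_def 1 2 by (simp add: distrib_left sum.distrib)
  qed
  \<comment> \<open>A shift along each chain of states plus the terms at delay
    \<open>d j - Suc r\<close>, in which the present outputs are expressed by \<open>c\<close> and
    \<open>e\<close>.\<close>
  define \<A> where "\<A> = (\<lambda>(j, r) \<tau>. (if \<tau> = (j, Suc r) then 1 else 0)
      + (\<Sum>b<p. \<beta> j (d j - Suc r) b * c b \<tau>))"
  define \<B> where "\<B> = (\<lambda>(j, r) s. (\<Sum>b<p. \<beta> j (d j - Suc r) b * e b s) + \<alpha> j (d j - Suc r) s)"
  \<comment> \<open>The initial state is read off from the data so that \<open>state_ok 0\<close>
    holds; afterwards the trajectory follows the state equation by construction.\<close>
  define X where "X = rec_nat (\<lambda>(j, r). y j r - (\<Sum>i\<le>r. g j (d j - r + i) i))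
    (\<lambda>t v \<sigma>. (\<Sum>\<tau>\<in>S. \<A> \<sigma> \<tau> * v \<tau>) + (\<Sum>s<m. \<B> \<sigma> s * u s t))"
  have X0: "X 0 (j, r) = y j r - (\<Sum>i\<le>r. g j (d j - r + i) i)" for j r
    by (simp add: X_def)
  have XSuc: "X (Suc t) \<sigma> = (\<Sum>\<tau>\<in>S. \<A> \<sigma> \<tau> * X t \<tau>) + (\<Sum>s<m. \<B> \<sigma> s * u s t)" for t \<sigma>
    by (simp add: X_def)
  have upd: "X (Suc t) (j, r) = (if (j, Suc r) \<in> S then X t (j, Suc r) else 0)
      + (\<Sum>b<p. \<beta> j (d j - Suc r) b * out (X t) (\<lambda>s. u s t) b)
      + (\<Sum>s<m. \<alpha> j (d j - Suc r) s * u s t)" for t j r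
    unfolding XSuc \<A>_def \<B>_def out_def
    by (simp add: distrib_right distrib_left sum.distrib delta_sum sum_distrib_left sum_distrib_right
          mult.assoc sum.swap[of _ S] sum.swap[of _ "{..<m}"])
  define state_ok where "state_ok t \<longleftrightarrow> (\<forall>j r. (j, r) \<in> S \<longrightarrow> t + r < T \<longrightarrow>
      X t (j, r) = y j (t + r) - (\<Sum>i\<le>r. g j (d j - r + i) (t + i)))" for t
  have y_out: "y j t = out (X t) (\<lambda>s. u s t) j" if "state_ok t" "t < T" "j < p" for t j
    using that(3)
  proof (induction j rule: less_induct)
    case (less j)
    have "y j t = (if (j, 0) \<in> S then X t (j, 0) else 0) + g j (d j) t"
    proof (cases "d j = 0")
      case True
      then show ?thesis using rel[of j t] less.prems that by (simp add: S_def)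
    next
      case False
      then have "(j, 0) \<in> S" using less.prems by (simp add: S_def)
      then show ?thesis using that unfolding state_ok_def by fastforce
    qed
    moreover have "(\<Sum>b<p. \<beta> j (d j) b * y b t) = (\<Sum>b<j. \<beta> j (d j) b * y b t)"
      using less.prems leading by (intro sum.mono_neutral_right) auto
    moreover have "(\<Sum>b<j. \<beta> j (d j) b * y b t) = (\<Sum>b<j. \<beta> j (d j) b * out (X t) (\<lambda>s. u s t) b)"
      using less by simp
    ultimately show ?case by (subst out) (simp add: g_def)
  qed
  have upd': "X (Suc t) (j, r) = (if (j, Suc r) \<in> S then X t (j, Suc r) else 0)
      + g j (d j - Suc r) t" if "state_ok t" "t < T" for t j r
    unfolding upd g_def using y_out[OF that] by simp
  have ok: "state_ok t" for t
  proof (induction t)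
    case 0
    then show ?case by (simp add: state_ok_def X0)
  next
    case (Suc t)
    show ?case unfolding state_ok_def
    proof (intro allI impI)
      fix j r assume jr: "(j, r) \<in> S" and t: "Suc t + r < T"
      have j: "j < p" and r: "r < d j" using jr by (auto simp: S_def)
      have t': "t < T" using t by simp
      show "X (Suc t) (j, r) = y j (Suc t + r) - (\<Sum>i\<le>r. g j (d j - r + i) (Suc t + i))"
      proof (cases "Suc r < d j")
        case True
        then have S': "(j, Suc r) \<in> S" using j by (simp add: S_def)
        have "X t (j, Suc r) = y j (t + Suc r) - (\<Sum>i\<le>Suc r. g j (d j - Suc r + i) (t + i))"
          using Suc.IH S' t unfolding state_ok_def by (metis add_Suc_shift)
        moreover have "(\<Sum>i\<le>Suc r. g j (d j - Suc r + i) (t + i)) =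
            g j (d j - Suc r) t + (\<Sum>i\<le>r. g j (d j - r + i) (Suc t + i))"
        proof -
          have "g j (d j - Suc r + Suc i) (t + Suc i) = g j (d j - r + i) (Suc t + i)" for i
          proof -
            have "d j - Suc r + Suc i = d j - r + i" using True by simp
            then show ?thesis by (simp only: add_Suc_shift)
          qed
          then show ?thesis unfolding sum.atMost_Suc_shift by simp
        qed
        ultimately show ?thesis
          using S' unfolding upd'[OF Suc.IH t'] by simp
      next
        \<comment> \<open>At the end of a chain there is no state \<open>(j, Suc r)\<close> to shift
          in; the relation \<open>rel\<close> expresses the sample \<open>y j (t + d j)\<close>
          instead.\<close>
        case False
        then have dj: "d j = Suc r" using r by simp
        then have "(j, Suc r) \<notin> S" by (simp add: S_def)
        moreover have "y j (t + Suc r) = g j 0 t + (\<Sum>i\<le>r. g j (Suc i) (t + Suc i))"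
          using rel[OF j, of t] t unfolding dj sum.atMost_Suc_shift by simp
        ultimately show ?thesis
          unfolding upd'[OF Suc.IH t'] by (simp add: dj)
      qed
    qed
  qed
  let ?A = "mat n n (\<lambda>(r, k). \<A> (f r) (f k))" and ?B = "mat n m (\<lambda>(r, s). \<B> (f r) s)"
    and ?C = "mat p n (\<lambda>(b, k). c b (f k))" and ?D = "mat p m (\<lambda>(b, s). e b s)"
  have "X (Suc t) (f r) = (\<Sum>k<n. ?A $$ (r, k) * X t (f k)) + (\<Sum>s<m. ?B $$ (r, s) * u s t)"
    if "r < n" for t r
    using that by (simp add: XSuc sum.reindex_bij_betw[OF f, symmetric])
  moreover have "y b t = (\<Sum>k<n. ?C $$ (b, k) * X t (f k)) + (\<Sum>s<m. ?D $$ (b, s) * u s t)"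
    if "b < p" "t < T" for b t
    using that by (simp add: y_out[OF ok] out_def sum.reindex_bij_betw[OF f, symmetric])
  ultimately show ?thesis
    unfolding n_def[symmetric]
    by (intro exI[of _ ?A] exI[of _ ?B] exI[of _ ?C] exI[of _ ?D] exI[of _ "\<lambda>t r. X t (f r)"]) simp
qed

section \<open>Ranks of observability matrices and the lag\<close>

lemma obs_mat_carrier:
  "A \<in> carrier_mat n n \<Longrightarrow> C \<in> carrier_mat p n \<Longrightarrow> obs_mat k C A \<in> carrier_mat (k * p) n"
  by (simp add: obs_mat_def)

text \<open>Appending a block leaves the status of the earlier rows unchanged, so the rank grows by
  the number of new rows in the last block.\<close>

lemma rank_obs_mat_Suc:
  assumes A: "A \<in> carrier_mat n n" and C: "C \<in> carrier_mat p n"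
  shows "mrank (obs_mat (Suc k) C A)
    = mrank (obs_mat k C A) + card {j. j < p \<and> \<not> row_dep (obs_mat (Suc k) C A) (k * p + j)}"
proof -
  have O: "obs_mat i C A \<in> carrier_mat (i * p) n" for i
    using A C by (rule obs_mat_carrier)
  have "row_dep (obs_mat k C A) i \<longleftrightarrow> row_dep (obs_mat (Suc k) C A) i" if "i < k * p" for i
    using that C by (intro row_dep_cong) (auto simp: obs_mat_def)
  then have "mrank (obs_mat k C A) = card {i. i < k * p \<and> \<not> row_dep (obs_mat (Suc k) C A) i}"
    using rank_eq_card_indep_rows[OF O] carrier_matD(1)[OF O] by (simp cong: conj_cong)
  moreover have "mrank (obs_mat (Suc k) C A)
      = card {i. i < k * p + p \<and> \<not> row_dep (obs_mat (Suc k) C A) i}"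
    using rank_eq_card_indep_rows[OF O, of "Suc k"] carrier_matD(1)[OF O, of "Suc k"]
    by (simp add: add.commute)
  ultimately show ?thesis by (simp add: card_filter_less_add)
qed

lemma rank_obs_mat_mono:
  assumes "A \<in> carrier_mat n n" "C \<in> carrier_mat p n" "k \<le> k'"
  shows "mrank (obs_mat k C A) \<le> mrank (obs_mat k' C A)"
  using assms(3) by (rule lift_Suc_mono_le[rotated]) (simp add: rank_obs_mat_Suc[OF assms(1,2)])

lemma rank_obs_mat_le:
  assumes "A \<in> carrier_mat n n" "C \<in> carrier_mat p n"
  shows "mrank (obs_mat k C A) \<le> n"
  using vec_space.rank_le_nc[OF obs_mat_carrier[OF assms, of k]]
    carrier_matD(1)[OF obs_mat_carrier[OF assms, of k]] by simp

text \<open>The rank is at most \<open>n\<close>, so it cannot grow strictly at each of the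
  \<open>n + 1\<close> steps starting from \<open>k = 0\<close>. Hence it stalls at some
  \<open>k \<le> n\<close>, and the minimum defining the lag exists.\<close>

lemma lag_properties:
  assumes A: "A \<in> carrier_mat n n" and C: "C \<in> carrier_mat p n"
  shows "lag C A \<le> n"
    and "mrank (obs_mat (Suc (lag C A)) C A) = mrank (obs_mat (lag C A) C A)"
proof -
  let ?r = "\<lambda>k. mrank (obs_mat k C A)"
  have "\<exists>k\<le>n. ?r (Suc k) = ?r k"
  proof (rule ccontr)
    assume "\<not> ?thesis"
    then have neq: "?r (Suc k) \<noteq> ?r k" if "k \<le> n" for k using that by blast
    have less: "?r k < ?r (Suc k)" if "k \<le> n" for k
      using neq[OF that] rank_obs_mat_mono[OF A C, of k "Suc k"] by linarith
    have "k \<le> ?r k" if "k \<le> Suc n" for k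
      using that
    proof (induction k)
      case (Suc k)
      then show ?case using less[of k] by linarith
    qed simp
    then show False using rank_obs_mat_le[OF A C, of "Suc n"] by (meson Suc_n_not_le_n le_refl le_trans)
  qed
  then obtain k where k: "k \<le> n" "?r (k + 1) = ?r k" by auto
  show "lag C A \<le> n"
    using Least_le[of "\<lambda>k. ?r (k + 1) = ?r k", OF k(2)] k(1) unfolding lag_def by linarith
  show "?r (Suc (lag C A)) = ?r (lag C A)"
    using LeastI[of "\<lambda>k. ?r (k + 1) = ?r k", OF k(2)] unfolding lag_def by simp
qed

lemma lag_le:
  "mrank (obs_mat (Suc k) C A) = mrank (obs_mat k C A) \<Longrightarrow> lag C A \<le> k"
  unfolding lag_def by (rule Least_le) simp

section \<open>Lower bounds for explaining systems\<close>

context io_data begin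

definition delta_nat :: "nat \<Rightarrow> nat" where
  "delta_nat k = card {j. j < p \<and> \<not> output_dep k j}"

definition q :: nat where
  "q = (LEAST k. k \<in> {0..T - 1} \<and> delta u y k = 0)"

text \<open>The sum may stop before \<open>q\<close> because the term at \<open>q\<close> is zero;
  see \<open>sum_delta\<close>. This will be the minimal number of states.\<close>

definition order :: nat where
  "order = (\<Sum>k<q. delta_nat k)"

lemma delta_eq_delta_nat: "k < T \<Longrightarrow> delta u y k = int (delta_nat k)"
  by (simp add: delta_eq delta_nat_def)

lemma q_less: "q < T" and delta_nat_q: "delta_nat q = 0" and delta_nat_pos: "k < q \<Longrightarrow> delta_nat k > 0"
proof -
  have "delta u y (T - 1) = 0"
    using delta_eq_delta_nat[of "T - 1"] T_pos by (simp add: delta_nat_def output_dep_last[unfolded One_nat_def])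
  then have "q \<in> {0..T - 1} \<and> delta u y q = 0"
    unfolding q_def using LeastI[of "\<lambda>k. k \<in> {0..T - 1} \<and> delta u y k = 0" "T - 1"] by simp
  then show *: "q < T" "delta_nat q = 0" using T_pos delta_eq_delta_nat[of q] by auto
  show "delta_nat k > 0" if "k < q"
    using not_less_Least[of k "\<lambda>k. k \<in> {0..T - 1} \<and> delta u y k = 0"] that * delta_eq_delta_nat[of k]
    unfolding q_def[symmetric] by auto
qed

lemma output_dep_q: "j < p \<Longrightarrow> output_dep q j"
  using delta_nat_q by (simp add: delta_nat_def)

text \<open>Each of the \<open>q\<close> summands is positive. This carries full rank from
  \<open>q\<close> blocks to the \<open>order\<close> blocks that occur in
  \<open>observable\<close>.\<close>

lemma q_le_order: "q \<le> order"
proof -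
  have "(\<Sum>k<q. 1) \<le> order" unfolding order_def by (intro sum_mono) (simp add: delta_nat_pos Suc_leI)
  then show ?thesis by simp
qed

lemma sum_delta: "(\<Sum>k = 0..q. delta u y k) = int order"
proof -
  have "(\<Sum>k = 0..q. delta u y k) = (\<Sum>k\<le>q. int (delta_nat k))"
    unfolding atMost_atLeast0 using q_less by (intro sum.cong refl delta_eq_delta_nat) simp
  also have "\<dots> = int order"
    by (simp add: order_def lessThan_Suc_atMost[symmetric] delta_nat_q)
  finally show ?thesis .
qed

context
  fixes n A B C D
  assumes A: "A \<in> carrier_mat n n" and B: "B \<in> carrier_mat n m"
    and C: "C \<in> carrier_mat p n" and D: "D \<in> carrier_mat p m"
    and ex: "explains u y (A, B, C, D)"
begin

text \<open>A component that is new in the data at delay \<open>k\<close> is also new in the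
  observability matrix, by contraposition of \<open>output_dep_of_row_dep_obs\<close>.\<close>

lemma rank_obs_mat_ge: "mrank (obs_mat k C A) + delta_nat k \<le> mrank (obs_mat (Suc k) C A)"
proof -
  have "delta_nat k \<le> card {j. j < p \<and> \<not> row_dep (obs_mat (Suc k) C A) (k * p + j)}"
    unfolding delta_nat_def using output_dep_of_row_dep_obs[OF A B C D ex] by (intro card_mono) auto
  then show ?thesis by (simp add: rank_obs_mat_Suc[OF A C])
qed

lemma order_le_rank: "order \<le> mrank (obs_mat q C A)"
proof -
  have "(\<Sum>i<k. delta_nat i) \<le> mrank (obs_mat k C A)" for k
  proof (induction k)
    case (Suc k)
    then show ?case using rank_obs_mat_ge[of k] by simp
  qed simp
  then show ?thesis by (simp add: order_def)
qed

text \<open>At the lag the rank does not grow, which forces \<open>delta_nat\<close> to vanish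
  there, whereas it is positive before \<open>q\<close>.\<close>

lemma q_le_lag: "q \<le> lag C A"
proof (rule ccontr)
  assume "\<not> ?thesis"
  then have "delta_nat (lag C A) > 0" by (intro delta_nat_pos) simp
  then show False using rank_obs_mat_ge[of "lag C A"] lag_properties(2)[OF A C] by linarith
qed

lemma order_le_states: "order \<le> n"
  using order_le_rank rank_obs_mat_le[OF A C, of q] by linarith

text \<open>With \<open>n = order\<close> the bounds \<open>order \<le> rank \<le> n\<close>
  collapse at \<open>q\<close> blocks: the rank is full there and stays full.\<close>

lemma minimal_states:
  assumes "n = order"
  shows "lag C A = q" and "observable C A"
proof -
  have q: "mrank (obs_mat q C A) = n"
    using order_le_rank rank_obs_mat_le[OF A C, of q] assms by linarith
  have rank: "mrank (obs_mat k C A) = n" if "q \<le> k" for k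
    using rank_obs_mat_mono[OF A C that] rank_obs_mat_le[OF A C, of k] q by linarith
  have "lag C A \<le> q" by (rule lag_le) (simp add: rank)
  then show "lag C A = q" using q_le_lag by simp
  show "observable C A" unfolding observable_def using A rank[of n] q_le_order assms by simp
qed

end

text \<open>The dependences at the first dependent delays \<open>d j\<close>, sorted by delay and
  component, are the input to \<open>realization\<close>.\<close>

lemma explains_order:
  "\<exists>A B C D. A \<in> carrier_mat order order \<and> B \<in> carrier_mat order m
    \<and> C \<in> carrier_mat p order \<and> D \<in> carrier_mat p m \<and> explains u y (A, B, C, D)"
proof -
  define d where "d j = (LEAST k. output_dep k j)" for j
  have output_dep_d: "output_dep (d j) j" for j
    unfolding d_def using output_dep_last by (rule LeastI)
  have d_le: "output_dep k j \<Longrightarrow> d j \<le> k" for k j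
    unfolding d_def by (rule Least_le)
  have output_dep_iff: "output_dep k j \<longleftrightarrow> d j \<le> k" for k j
    using output_dep_d d_le output_dep_mono by blast
  have order: "order = (\<Sum>j<p. d j)"
  proof -
    \<comment> \<open>Double counting of the pairs \<open>(k, j)\<close> with
      \<open>k < d j\<close>, using that dependence persists once it occurs.\<close>
    have "delta_nat k = (\<Sum>j<p. if k < d j then 1 else 0)" for k
      by (simp add: delta_nat_def output_dep_iff not_le sum.If_cases Int_def)
    then have "order = (\<Sum>j<p. \<Sum>k<q. if k < d j then 1 else 0)"
      unfolding order_def by (simp add: sum.swap[of _ "{..<q}"])
    also have "\<dots> = (\<Sum>j<p. d j)"
    proof (intro sum.cong refl)
      fix j assume "j \<in> {..<p}"
      then have "d j \<le> q" by (intro d_le output_dep_q) simp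
      then have "{..<q} \<inter> {k. k < d j} = {..<d j}" by auto
      then show "(\<Sum>k<q. if k < d j then 1 else 0) = d j" by (simp add: sum.If_cases)
    qed
    finally show ?thesis .
  qed
  have "\<forall>j. \<exists>c a. \<forall>t. t + d j < T \<longrightarrow> y $$ (j, t + d j)
      - (\<Sum>l<d j * p + j. c l * y $$ (l mod p, t + l div p))
      = (\<Sum>l<(d j + 1) * m. a l * u $$ (l mod m, t + l div m))"
    using output_dep_d unfolding output_dep_def input_lin_def by blast
  from choice[OF this] obtain c where "\<forall>j. \<exists>a. \<forall>t. t + d j < T \<longrightarrow> y $$ (j, t + d j)
      - (\<Sum>l<d j * p + j. c j l * y $$ (l mod p, t + l div p))
      = (\<Sum>l<(d j + 1) * m. a l * u $$ (l mod m, t + l div m))" ..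
  from choice[OF this] obtain a where ca: "\<And>j t. t + d j < T \<Longrightarrow> y $$ (j, t + d j)
      - (\<Sum>l<d j * p + j. c j l * y $$ (l mod p, t + l div p))
      = (\<Sum>l<(d j + 1) * m. a j l * u $$ (l mod m, t + l div m))"
    by blast
  \<comment> \<open>The cut-off at row \<open>(d j, j)\<close> makes the coefficients at delay
    \<open>d j\<close> vanish for \<open>b \<ge> j\<close>, which is the condition
    \<open>leading\<close>.\<close>
  define \<beta> where "\<beta> j i b = (if i * p + b < d j * p + j then c j (i * p + b) else 0)" for j i b
  define \<alpha> where "\<alpha> j i s = a j (i * m + s)" for j i s
  have rel: "y $$ (j, t + d j) = (\<Sum>i\<le>d j. (\<Sum>b<p. \<beta> j i b * y $$ (b, t + i))
      + (\<Sum>s<m. \<alpha> j i s * u $$ (s, t + i)))" if j: "j < p" and t: "t + d j < T" for j t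
  proof -
    have "(\<Sum>l<d j * p + j. c j l * y $$ (l mod p, t + l div p)) = (\<Sum>l<Suc (d j) * p.
        (if l < d j * p + j then c j l else 0) * y $$ (l mod p, t + l div p))"
      using j by (intro sum.mono_neutral_cong_left) auto
    also have "\<dots> = (\<Sum>i\<le>d j. \<Sum>b<p. \<beta> j i b * y $$ (b, t + i))"
      unfolding sum_blocks lessThan_Suc_atMost by (intro sum.cong refl) (simp add: \<beta>_def)
    finally have 1: "(\<Sum>l<d j * p + j. c j l * y $$ (l mod p, t + l div p))
      = (\<Sum>i\<le>d j. \<Sum>b<p. \<beta> j i b * y $$ (b, t + i))" .
    have "(\<Sum>l<Suc (d j) * m. a j l * u $$ (l mod m, t + l div m))
        = (\<Sum>i\<le>d j. \<Sum>s<m. \<alpha> j i s * u $$ (s, t + i))"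
      unfolding sum_blocks lessThan_Suc_atMost by (intro sum.cong refl) (simp add: \<alpha>_def)
    then show ?thesis using ca[OF t] 1 by (simp add: sum.distrib)
  qed
  have "\<exists>A B C D x. A \<in> carrier_mat order order \<and> B \<in> carrier_mat order m
    \<and> C \<in> carrier_mat p order \<and> D \<in> carrier_mat p m
    \<and> (\<forall>t<T. \<forall>r<order. x (Suc t) r =
        (\<Sum>k<order. A $$ (r, k) * x t k) + (\<Sum>s<m. B $$ (r, s) * u $$ (s, t)))
    \<and> (\<forall>t<T. \<forall>b<p. y $$ (b, t) =
        (\<Sum>k<order. C $$ (b, k) * x t k) + (\<Sum>s<m. D $$ (b, s) * u $$ (s, t)))"
    unfolding order
    by (rule realization[where \<alpha> = \<alpha> and \<beta> = \<beta>]) (use rel in \<open>auto simp: \<beta>_def\<close>)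
  then obtain A B C D x where sys: "A \<in> carrier_mat order order" "B \<in> carrier_mat order m"
    "C \<in> carrier_mat p order" "D \<in> carrier_mat p m"
    and state: "\<And>t r. t < T \<Longrightarrow> r < order \<Longrightarrow> x (Suc t) r =
        (\<Sum>k<order. A $$ (r, k) * x t k) + (\<Sum>s<m. B $$ (r, s) * u $$ (s, t))"
    and out: "\<And>t b. t < T \<Longrightarrow> b < p \<Longrightarrow> y $$ (b, t) =
        (\<Sum>k<order. C $$ (b, k) * x t k) + (\<Sum>s<m. D $$ (b, s) * u $$ (s, t))"
    by blast
  let ?x = "mat order (T + 1) (\<lambda>(r, t). x t r)"
  have "explains u y (A, B, C, D)"
    unfolding explains.simps
  proof (intro bexI[of _ ?x] allI impI conjI)
    show "?x \<in> carrier_mat (dim_row A) (dim_col u + 1)" using sys by simp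
    fix t assume "t < dim_col u"
    then have t: "t < T" by simp
    show "col ?x (t + 1) = A *\<^sub>v col ?x t + B *\<^sub>v col u t"
      using sys t u state[OF t] by (intro eq_vecI) (auto simp: scalar_prod_def atLeast0LessThan)
    show "col y t = C *\<^sub>v col ?x t + D *\<^sub>v col u t"
      using sys t u y out[OF t] by (intro eq_vecI) (auto simp: scalar_prod_def atLeast0LessThan)
  qed
  then show ?thesis using sys by blast
qed

section \<open>The minimal invariants and the sets of explaining systems\<close>

lemma expl_lag_iff: "(A, B, C, D) \<in> expl_lag u y l n \<longleftrightarrow>
    A \<in> carrier_mat n n \<and> B \<in> carrier_mat n m \<and> C \<in> carrier_mat p n \<and> D \<in> carrier_mat p m
    \<and> lag C A = l \<and> explains u y (A, B, C, D)"
  using lag_properties(1)[of A n C p]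
  by (auto simp: expl_lag_def expl_def systems_def sys_states_def sys_lag_def simp del: explains.simps)

lemma expl_states_iff: "(A, B, C, D) \<in> expl_states u y n \<longleftrightarrow>
    A \<in> carrier_mat n n \<and> B \<in> carrier_mat n m \<and> C \<in> carrier_mat p n \<and> D \<in> carrier_mat p m
    \<and> explains u y (A, B, C, D)"
  using lag_properties(1)[of A n C p]
  by (auto simp: expl_states_def expl_def systems_def sys_states_def sys_lag_def simp del: explains.simps)

lemma expl_lag_subset_systems: "expl_lag u y l n \<subseteq> systems m p"
  by (auto simp: expl_lag_def expl_def)

lemma expl_states_order: "expl_states u y order = expl_lag u y q order"
  using minimal_states(1)[OF _ _ _ _ _ refl]
  by (auto simp: expl_states_iff expl_lag_iff simp del: explains.simps)

lemma expl_states_order_nonempty: "expl_states u y order \<noteq> {}"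
proof -
  obtain A B C D where "(A, B, C, D) \<in> expl_states u y order"
    using explains_order unfolding expl_states_iff by (elim exE)
  then show ?thesis by blast
qed

lemma n_min_eq: "n_min u y = order"
  unfolding n_min_def
proof (rule Least_equality)
  show "expl_states u y order \<noteq> {}" by (rule expl_states_order_nonempty)
  show "order \<le> n" if "expl_states u y n \<noteq> {}" for n
    using that order_le_states by (auto simp: expl_states_iff simp del: explains.simps)
qed

lemma l_min_eq: "l_min u y = q"
  unfolding l_min_def
proof (rule Least_equality)
  show "\<exists>n. expl_lag u y q n \<noteq> {}"
    using expl_states_order_nonempty unfolding expl_states_order ..
  show "q \<le> l" if "\<exists>n. expl_lag u y l n \<noteq> {}" for l
    using that q_le_lag by (auto simp: expl_lag_iff simp del: explains.simps)
qed

lemma expl_lag_order_subset: "expl_lag u y q order \<subseteq> obs_systems m p"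
  using minimal_states(2)[OF _ _ _ _ _ refl] expl_lag_subset_systems[of q order]
  by (auto simp: obs_systems_def expl_lag_iff simp del: explains.simps)

end

section \<open>Strictness of the inclusion\<close>

lemma obs_systemsI:
  assumes "A \<in> carrier_mat n n" "B \<in> carrier_mat n m" "C \<in> carrier_mat p n" "D \<in> carrier_mat p m"
    and "observable C A"
  shows "(A, B, C, D) \<in> obs_systems m p"
  using assms lag_properties(1)[OF assms(1,3)]
  by (auto simp: obs_systems_def systems_def sys_states_def sys_lag_def)

text \<open>With \<open>k\<close> the minimal number of states, such a system lies outside the set
  of minimal explaining systems. The witness has one state, read by every output, if
  \<open>k = 0\<close>, and no state otherwise.\<close>

lemma exists_obs_system:
  assumes p: "p > 0"
  shows "\<exists>A B C D. A \<notin> carrier_mat k k \<and> (A, B, C, D) \<in> obs_systems m p"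
proof (cases "k = 0")
  case True
  let ?A = "0\<^sub>m 1 1 :: real mat" and ?C = "mat p 1 (\<lambda>_. 1) :: real mat"
  have AC: "?A \<in> carrier_mat 1 1" "?C \<in> carrier_mat p 1" by simp_all
  have "obs_mat (Suc 0) ?C ?A $$ (0, 0) = 1"
    using p by (simp add: obs_mat_def)
  then have "\<not> row_dep (obs_mat (Suc 0) ?C ?A) (0 * p + 0)"
    using p by (auto simp: row_dep_def obs_mat_def)
  then have "{j. j < p \<and> \<not> row_dep (obs_mat (Suc 0) ?C ?A) (0 * p + j)} \<noteq> {}"
    using p by blast
  then have "card {j. j < p \<and> \<not> row_dep (obs_mat (Suc 0) ?C ?A) (0 * p + j)} > 0"
    by (simp add: card_gt_0_iff)
  then have "mrank (obs_mat 1 ?C ?A) = 1"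
    using rank_obs_mat_Suc[OF AC, of 0] rank_obs_mat_le[OF AC, of 1] by simp
  then have "observable ?C ?A" by (simp add: observable_def)
  then have "(?A, 0\<^sub>m 1 m, ?C, 0\<^sub>m p m) \<in> obs_systems m p"
    by (intro obs_systemsI[OF AC(1) _ AC(2)]) auto
  moreover have "?A \<notin> carrier_mat k k" using True by auto
  ultimately show ?thesis by blast
next
  case False
  let ?A = "0\<^sub>m 0 0 :: real mat" and ?C = "0\<^sub>m p 0 :: real mat"
  have AC: "?A \<in> carrier_mat 0 0" "?C \<in> carrier_mat p 0" by simp_all
  have "observable ?C ?A"
    using rank_obs_mat_le[OF AC, of 0] by (simp add: observable_def)
  then have "(?A, 0\<^sub>m 0 m, ?C, 0\<^sub>m p m) \<in> obs_systems m p"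
    by (intro obs_systemsI[OF AC(1) _ AC(2)]) auto
  moreover have "?A \<notin> carrier_mat k k" using False by auto
  ultimately show ?thesis by blast
qed

theorem theorem8:
  fixes m p T q :: nat and u y :: "real mat"
  assumes "m \<ge> 1" and "p \<ge> 1" and "T \<ge> 1"
    and "u \<in> carrier_mat m T" and "y \<in> carrier_mat p T"
    and "u \<noteq> 0\<^sub>m m T"
    and "\<exists>\<Sigma> \<in> expl u y. minimal_sys \<Sigma>"
    and "q = (LEAST k. k \<in> {0..T - 1} \<and> delta u y k = 0)"
  shows "l_min u y = q
    \<and> int (n_min u y) = (\<Sum>i = 0..l_min u y. delta u y i)
    \<and> expl_states u y (n_min u y) = expl_lag u y (l_min u y) (n_min u y)
    \<and> expl_lag u y (l_min u y) (n_min u y) \<subset> obs_systems m p"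
proof -
  interpret io_data m p T u y
    using assms by unfold_locales auto
  have q: "q = io_data.q T u y" using assms(8) unfolding q_def .
  obtain A B C D where "A \<notin> carrier_mat order order" "(A, B, C, D) \<in> obs_systems m p"
    using exists_obs_system[OF p] by blast
  then have "expl_lag u y (l_min u y) (n_min u y) \<subset> obs_systems m p"
    using expl_lag_order_subset expl_lag_iff[of A B C D] unfolding l_min_eq n_min_eq by blast
  then show ?thesis
    unfolding q l_min_eq n_min_eq using sum_delta expl_states_order by simp
qed

end
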